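(* Let $T$ be an infinite tree. Then the following conditions are equivalent: (i) $T$ is almost a ray. (ii) For every non-degenerate labeling $l\colon V(T)\to\mathbb{R}^{+}$, the ultrametric space $(V(T),d_l)$ is totally bounded if and only if there is an infinite set $A\subseteq V(T)$ that is totally bounded with respect to $d_l$.
   Context: All graphs are simple (undirected, with nonempty vertex set, no loops or multiple edges) and may be finite or infinite, of arbitrary cardinality. $V(G)$ and $E(G)$ denote the vertex and edge sets of a graph $G$; $H\subseteq G$ means that $H$ is a subgraph of $G$, and the union of subgraphs has as vertex set (edge set) the union of the vertex sets (edge sets). A tree is a connected graph without cycles; a graph is infinite if its vertex set is infinite. $\mathbb{R}^{+}=[0,\infty)$. A labeling $l\colon V(T)\to\mathbb{R}^{+}$ of a tree $T$ is non-degenerate if $\max\{l(u),l(v)\}>0$ for every edge $\{u,v\}$ of $T$. For a labeling $l$, the function $d_l\colon V(T)\times V(T)\to\mathbb{R}^{+}$ is defined by $d_l(u,u)=0$ and, for $u\ne v$, $d_l(u,v)=\max_{w\in V(P)} l(w)$, where $P$ is the unique path joining $u$ and $v$ in $T$ (endpoints included). When $l$ is non-degenerate, $d_l$ is an ultrametric on $V(T)$. A ray is an infinite graph $R$ with $V(R)=\{v_1,v_2,\dots,v_n,\dots\}$ (the $v_i$ pairwise distinct) and $E(R)=\{\{v_1,v_2\},\{v_2,v_3\},\dots,\{v_n,v_{n+1}\},\dots\}$. An infinite tree $T$ is almost a ray if there are a ray $R\subseteq T$ and a finite tree $T_0\subseteq T$ such that $T=T_0\cup R$. A metric space is totally bounded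 if for every $r\in(0,\infty)$ it is covered by finitely many open balls of radius $r$; a subset of a metric space is totally bounded if it is totally bounded as a metric subspace. *)

theory Defs
  imports "HOL-Analysis.Abstract_Metric_Spaces"
begin

text \<open>
  A simple graph is given by its vertex set \<open>V\<close> and its edge set \<open>E\<close>, a set of two-element subsets
  of \<open>V\<close>; there is no bound on the cardinality of \<open>V\<close>.
\<close>

definition simple_graph :: "'a set \<Rightarrow> 'a set set \<Rightarrow> bool" where
  "simple_graph V E \<longleftrightarrow> V \<noteq> {} \<and> (\<forall>e\<in>E. \<exists>u\<in>V. \<exists>v\<in>V. u \<noteq> v \<and> e = {u, v})"

definition subgraph_of :: "'a set \<Rightarrow> 'a set set \<Rightarrow> 'a set \<Rightarrow> 'a set set \<Rightarrow> bool" where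
  "subgraph_of V' E' V E \<longleftrightarrow> simple_graph V' E' \<and> simple_graph V E \<and> V' \<subseteq> V \<and> E' \<subseteq> E"

text \<open>A path is represented by the list of its (pairwise distinct) vertices.\<close>

definition graph_path :: "'a set \<Rightarrow> 'a set set \<Rightarrow> 'a list \<Rightarrow> bool" where
  "graph_path V E p \<longleftrightarrow>
     p \<noteq> [] \<and> distinct p \<and> set p \<subseteq> V \<and> successively (\<lambda>x y. {x, y} \<in> E) p"

definition path_joining :: "'a set \<Rightarrow> 'a set set \<Rightarrow> 'a \<Rightarrow> 'a \<Rightarrow> 'a list \<Rightarrow> bool" where
  "path_joining V E u v p \<longleftrightarrow> graph_path V E p \<and> hd p = u \<and> last p = v"

definition graph_connected :: "'a set \<Rightarrow> 'a set set \<Rightarrow> bool" where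
  "graph_connected V E \<longleftrightarrow> (\<forall>u\<in>V. \<forall>v\<in>V. \<exists>p. path_joining V E u v p)"

definition graph_cycle :: "'a set \<Rightarrow> 'a set set \<Rightarrow> 'a list \<Rightarrow> bool" where
  "graph_cycle V E c \<longleftrightarrow> graph_path V E c \<and> length c \<ge> 3 \<and> {last c, hd c} \<in> E"

definition is_tree :: "'a set \<Rightarrow> 'a set set \<Rightarrow> bool" where
  "is_tree V E \<longleftrightarrow> simple_graph V E \<and> graph_connected V E \<and> \<not> (\<exists>c. graph_cycle V E c)"

definition is_ray :: "'a set \<Rightarrow> 'a set set \<Rightarrow> bool" where
  "is_ray V E \<longleftrightarrow> (\<exists>v :: nat \<Rightarrow> 'a. inj v \<and> V = range v \<and> E = range (\<lambda>n. {v n, v (Suc n)}))"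

definition almost_ray :: "'a set \<Rightarrow> 'a set set \<Rightarrow> bool" where
  "almost_ray V E \<longleftrightarrow>
     is_tree V E \<and> infinite V \<and>
     (\<exists>VR ER V0 E0.
        is_ray VR ER \<and> subgraph_of VR ER V E \<and>
        is_tree V0 E0 \<and> finite V0 \<and> subgraph_of V0 E0 V E \<and>
        V = V0 \<union> VR \<and> E = E0 \<union> ER)"

text \<open>Labelings are total functions; only their values on \<open>V\<close> matter.\<close>

definition nondegenerate_labeling :: "'a set \<Rightarrow> 'a set set \<Rightarrow> ('a \<Rightarrow> real) \<Rightarrow> bool" where
  "nondegenerate_labeling V E l \<longleftrightarrow>
     (\<forall>v\<in>V. l v \<ge> 0) \<and> (\<forall>u v. {u, v} \<in> E \<longrightarrow> max (l u) (l v) > 0)"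

text \<open>
  The value \<open>0\<close> outside \<open>V\<close> is a convention, needed because the library's
  \<^locale>\<open>Metric_space\<close> requires symmetry and nonnegativity on the whole type.
\<close>

definition label_dist :: "'a set \<Rightarrow> 'a set set \<Rightarrow> ('a \<Rightarrow> real) \<Rightarrow> 'a \<Rightarrow> 'a \<Rightarrow> real" where
  "label_dist V E l u v =
     (if u \<in> V \<and> v \<in> V \<and> u \<noteq> v
      then Max (l ` set (THE p. path_joining V E u v p)) else 0)"

lemma path_joining_tl:
  assumes "path_joining V E u v (u # y # p)"
  shows "path_joining V E y v (y # p)"
  using assms by (auto simp: path_joining_def graph_path_def)

lemma path_joining_rev:
  assumes "path_joining V E u v p"
  shows "path_joining V E v u (rev p)"
  using assms by (auto simp: path_joining_def graph_path_def hd_rev last_rev insert_commute)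

lemma path_joining_unique:
  assumes acyc: "\<not> (\<exists>c. graph_cycle V E c)"
  shows "path_joining V E u v p \<Longrightarrow> path_joining V E u v q \<Longrightarrow> p = q"
proof (induction p arbitrary: q u)
  case Nil
  then show ?case by (simp add: path_joining_def graph_path_def)
next
  case (Cons a p')
  note P = Cons.prems(1) and Q = Cons.prems(2)
  have a: "a = u" using P by (simp add: path_joining_def)
  obtain q' where q: "q = u # q'"
    using Q by (cases q) (auto simp: path_joining_def graph_path_def)
  show ?case
  proof (cases "p' = [] \<or> q' = []")
    case True
    then show ?thesis using P Q a q
      by (auto simp: path_joining_def graph_path_def split: if_splits)
  next
    case False
    then obtain x p2 y q2 where p': "p' = x # p2" and q': "q' = y # q2"
      by (meson neq_Nil_conv)
    show ?thesis
    proof (cases "x = y")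
      case True
      then show ?thesis
        using Cons.IH[of x q'] path_joining_tl P Q a q p' q' by metis
    next
      case xy: False
      have "last p' = v" "last q' = v"
        using P Q a q p' q' by (auto simp: path_joining_def)
      then have "\<exists>z\<in>set p'. z \<in> set q'"
        using p' q' by (metis last_in_set list.distinct(1))
      then obtain r z s where p3: "p' = r @ z # s" and z: "z \<in> set q'"
        and r: "\<forall>w\<in>set r. w \<notin> set q'"
        using split_list_first_prop[of p' "\<lambda>w. w \<in> set q'"] by metis
      obtain c d where q3: "q' = c @ z # d" using z by (meson split_list)
      let ?c = "u # r @ z # rev c"
      have P': "distinct (u # r @ z # s)" "set (u # r @ z # s) \<subseteq> V"
        "successively (\<lambda>x y. {x, y} \<in> E) (u # r @ z # s)"
        using P a p3 by (auto simp: path_joining_def graph_path_def)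
      have Q': "distinct (u # c @ z # d)" "set (u # c @ z # d) \<subseteq> V"
        "successively (\<lambda>x y. {x, y} \<in> E) (u # c @ z # d)"
        using Q q q3 by (auto simp: path_joining_def graph_path_def)
      have "length ?c \<ge> 3"
        using xy p' q' p3 q3 by (cases r; cases c) auto
      moreover have "distinct ?c" using P' Q' r q3 by auto
      moreover have "set ?c \<subseteq> V" using P' Q' by auto
      moreover have "successively (\<lambda>x y. {x, y} \<in> E) (u # r @ [z])"
      proof -
        have "successively (\<lambda>x y. {x, y} \<in> E) ((u # r @ [z]) @ s)" using P'(3) by simp
        then show ?thesis unfolding successively_append_iff by blast
      qed
      moreover have Z: "successively (\<lambda>x y. {x, y} \<in> E) (z # rev c @ [u])"
      proof -
        have "successively (\<lambda>x y. {x, y} \<in> E) ((u # c @ [z]) @ d)" using Q'(3) by simp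
        then have "successively (\<lambda>x y. {x, y} \<in> E) (u # c @ [z])"
          unfolding successively_append_iff by blast
        then have "successively (\<lambda>x y. {y, x} \<in> E) (rev (u # c @ [z]))"
          by (simp only: successively_rev)
        then show ?thesis by (simp add: insert_commute)
      qed
      moreover have "successively (\<lambda>x y. {x, y} \<in> E) (z # rev c)"
        "{last (z # rev c), u} \<in> E"
        using Z successively_append_iff[of "\<lambda>x y. {x, y} \<in> E" "z # rev c" "[u]"] by auto
      moreover have "successively (\<lambda>x y. {x, y} \<in> E) ?c"
        using calculation(4,6) successively_append_iff[of "\<lambda>x y. {x, y} \<in> E" "u # r" "z # rev c"]
          successively_append_iff[of "\<lambda>x y. {x, y} \<in> E" "u # r" "[z]"] by auto
      moreover have "last ?c = last (z # rev c)" by simp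
      ultimately have "graph_cycle V E ?c"
        unfolding graph_cycle_def graph_path_def
        by (metis list.discI list.sel(1))
      then show ?thesis using acyc by blast
    qed
  qed
qed

lemma path_joining_trans:
  assumes "path_joining V E u v p" "path_joining V E v w q"
  obtains r where "path_joining V E u w r" "set r \<subseteq> set p \<union> set q"
proof -
  have "\<exists>z\<in>set p. z \<in> set q"
    using assms unfolding path_joining_def graph_path_def by (metis last_in_set hd_in_set)
  then obtain a z b where p: "p = a @ z # b" and z: "z \<in> set q"
    and a: "\<forall>w\<in>set a. w \<notin> set q"
    using split_list_first_prop[of p "\<lambda>w. w \<in> set q"] by metis
  obtain c d where q: "q = c @ z # d" using z by (meson split_list)
  have "path_joining V E u w (a @ z # d)"
    using assms a unfolding p q path_joining_def graph_path_def
    by (auto simp: successively_append_iff hd_append split: if_splits)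
  then show ?thesis by (rule that) (auto simp: p q)
qed

lemma tree_path_ex1:
  assumes "is_tree V E" "u \<in> V" "v \<in> V"
  shows "\<exists>!p. path_joining V E u v p"
  using assms path_joining_unique unfolding is_tree_def graph_connected_def by metis

lemma label_dist_eq:
  assumes "is_tree V E" "path_joining V E u v p" "u \<noteq> v"
  shows "label_dist V E l u v = Max (l ` set p)"
proof -
  have uv: "u \<in> V" "v \<in> V"
    using assms(2) unfolding path_joining_def graph_path_def by auto
  then have "(THE p. path_joining V E u v p) = p"
    using tree_path_ex1[OF assms(1) uv] assms(2) by (meson the1_equality)
  then show ?thesis using uv assms(3) by (simp add: label_dist_def)
qed

theorem label_dist_ultrametric:
  assumes T: "is_tree V E" and l: "nondegenerate_labeling V E l"
  shows "Metric_space V (label_dist V E l)"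
    and "\<lbrakk>x \<in> V; y \<in> V; z \<in> V\<rbrakk> \<Longrightarrow>
      label_dist V E l x z \<le> max (label_dist V E l x y) (label_dist V E l y z)"
proof -
  let ?d = "label_dist V E l"
  have ex: "\<exists>p. path_joining V E u v p" if "u \<in> V" "v \<in> V" for u v
    using tree_path_ex1[OF T that] by blast
  have pos: "?d u v > 0" if "u \<in> V" "v \<in> V" "u \<noteq> v" for u v
  proof -
    obtain p where p: "path_joining V E u v p" using ex \<open>u \<in> V\<close> \<open>v \<in> V\<close> by blast
    then obtain y q where q: "p = u # y # q"
      using \<open>u \<noteq> v\<close> unfolding path_joining_def graph_path_def
      by (metis hd_Cons_tl last_ConsL)
    have "{u, y} \<in> E" using p q by (simp add: path_joining_def graph_path_def)
    then have "max (l u) (l y) > 0" using l by (simp add: nondegenerate_labeling_def)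
    then have "\<exists>w\<in>set p. l w > 0" using q by (auto simp: max_def split: if_splits)
    then show ?thesis
      using label_dist_eq[OF T p \<open>u \<noteq> v\<close>, of l] q
      by (metis (no_types, lifting) Max_gr_iff List.finite_set finite_imageI image_is_empty
          imageI set_empty list.distinct(1))
  qed
  have nn: "?d u v \<ge> 0" for u v
    using pos[of u v] by (cases "u \<in> V \<and> v \<in> V \<and> u \<noteq> v") (auto simp: label_dist_def)
  have comm: "?d u v = ?d v u" for u v
  proof (cases "u \<in> V \<and> v \<in> V \<and> u \<noteq> v")
    case True
    then obtain p where p: "path_joining V E u v p" using ex by blast
    show ?thesis
      using label_dist_eq[OF T p] label_dist_eq[OF T path_joining_rev[OF p]] True by auto
  qed (auto simp: label_dist_def)
  have ultra: "?d u w \<le> max (?d u v) (?d v w)" if uvw: "u \<in> V" "v \<in> V" "w \<in> V" for u v w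
  proof (cases "u = v \<or> v = w \<or> u = w")
    case True
    then show ?thesis using nn[of u v] nn[of v w] nn[of u w] by (auto simp: label_dist_def)
  next
    case False
    obtain p q where p: "path_joining V E u v p" and q: "path_joining V E v w q"
      using ex uvw by meson
    obtain r where r: "path_joining V E u w r" and sub: "set r \<subseteq> set p \<union> set q"
      using path_joining_trans[OF p q] .
    have ne: "set p \<noteq> {}" "set q \<noteq> {}" "set r \<noteq> {}"
      using p q r by (auto simp: path_joining_def graph_path_def)
    have "Max (l ` set r) \<le> Max (l ` (set p \<union> set q))"
      using ne sub by (intro Max_mono) auto
    also have "\<dots> = max (Max (l ` set p)) (Max (l ` set q))"
      using ne by (simp add: image_Un Max_Un)
    finally show ?thesis
      using label_dist_eq[OF T] p q r False by metis
  qed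
  then show "\<lbrakk>x \<in> V; y \<in> V; z \<in> V\<rbrakk> \<Longrightarrow> ?d x z \<le> max (?d x y) (?d y z)" .
  show "Metric_space V ?d"
  proof
    fix x y assume "x \<in> V" "y \<in> V"
    then show "?d x y = 0 \<longleftrightarrow> x = y" using pos[of x y] by (auto simp: label_dist_def)
  next
    fix x y z assume "x \<in> V" "y \<in> V" "z \<in> V"
    then show "?d x z \<le> ?d x y + ?d y z" using ultra[of x y z] nn[of x y] nn[of y z] by linarith
  qed (use nn comm in auto)
qed

end

theory Submission
  imports Defs
begin

text \<open>
  In one direction, let the tree be a ray \<open>v 0, v 1, \<dots>\<close> together with a finite tree.  An infinite
  totally bounded set meets the ray infinitely often, so for each \<open>\<epsilon>\<close> one ball of radius \<open>\<epsilon>\<close>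
  contains infinitely many \<open>v n\<close>.  By the ultrametric inequality these are pairwise closer than
  \<open>\<epsilon>\<close>, and the segments of the ray between them carry labels below \<open>\<epsilon>\<close>.  So the labels of the ray
  tend to zero, a tail of the ray has diameter below \<open>\<epsilon>\<close>, and only finitely many vertices lie
  outside that tail.

  In the other direction, labelings force the shape of the tree.  If a sequence \<open>a\<close> of distinct
  vertices is labeled by \<open>1 / (n + 1)\<close>, an independent set \<open>C\<close> by \<open>0\<close> and every other vertex by
  \<open>1\<close>, and if the path from \<open>a m\<close> to \<open>a n\<close> uses only vertices of \<open>C\<close> and later terms of the
  sequence, then \<open>range a\<close> is totally bounded, whereas the vertices labeled \<open>1\<close> have pairwise
  distance at least \<open>1\<close>.  Hence the metric condition leaves only finitely many of them
  (\<open>cofinite_of_labeling_condition\<close>).  Applied to half of the neighbours of a vertex of infinite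
  degree (with that vertex as \<open>C\<close>) this is absurd, so the tree is locally finite, and Koenig's lemma
  gives a ray.  Applied to that ray (with \<open>C\<close> empty) it says that all but finitely many vertices are
  on the ray.  A tree with this property is almost a ray: the finite part is spanned by the paths
  from the origin of the ray to the vertices off the ray.
\<close>

section \<open>Paths\<close>

lemma path_joining_prefix:
  assumes "path_joining V E u v (xs @ ys)" "xs \<noteq> []"
  shows "path_joining V E u (last xs) xs"
  using assms by (auto simp: path_joining_def graph_path_def successively_append_iff)

lemma path_joining_snoc:
  assumes "path_joining V E u v p" "{v, w} \<in> E" "w \<in> V" "w \<notin> set p"
  shows "path_joining V E u w (p @ [w])"
  using assms by (auto simp: path_joining_def graph_path_def successively_append_iff)

lemma path_joining_sequence_segment:
  assumes "inj v" "range v \<subseteq> V" "\<And>n. {v n, v (Suc n)} \<in> E" "i \<le> j"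
  shows "path_joining V E (v i) (v j) (map v [i..<Suc j])"
proof -
  have "successively (\<lambda>x y. {x, y} \<in> E) (map v [i..<Suc j])"
    unfolding successively_conv_nth using assms(3) by (auto simp del: upt_Suc)
  moreover have "distinct (map v [i..<Suc j])"
    using assms(1) by (auto simp: distinct_map inj_on_def simp del: upt_Suc)
  ultimately show ?thesis
    using assms(2,4) unfolding path_joining_def graph_path_def
    by (auto simp: hd_map last_map simp del: upt_Suc)
qed

text \<open>
  Equal end points are included: there the distance is \<open>0\<close>, although the one-vertex path may carry
  a positive label, and \<open>0 < e\<close> gives the bound.
\<close>
lemma label_dist_less:
  assumes "is_tree V E" "path_joining V E u v p" "\<And>x. x \<in> set p \<Longrightarrow> l x < e" "0 < e"
  shows "label_dist V E l u v < e"
proof (cases "u = v")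
  case False
  then show ?thesis
    using label_dist_eq[OF assms(1,2), of l] assms(2,3)
    by (auto simp: path_joining_def graph_path_def)
qed (use assms(4) in \<open>simp add: label_dist_def\<close>)

lemma label_le_label_dist:
  assumes "is_tree V E" "path_joining V E u v p" "u \<noteq> v" "x \<in> set p"
  shows "l x \<le> label_dist V E l u v"
  using label_dist_eq[OF assms(1-3), of l] assms(4) by simp

section \<open>Total boundedness in a tree that is almost a ray\<close>

text \<open>
  The tail of the ray starting at a suitable \<open>v i\<close> has diameter below \<open>e\<close>, because infinitely many
  of its vertices lie in a single ball of radius \<open>e\<close> and the segments between them exhaust the tail.
\<close>
lemma mtotally_bounded_of_infinite_subset:
  assumes T: "is_tree V E" and l: "nondegenerate_labeling V E l"
    and v: "inj v" "range v \<subseteq> V" "\<And>n. {v n, v (Suc n)} \<in> E"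
    and fin: "finite (V - range v)"
    and A: "A \<subseteq> V" "infinite A" "Metric_space.mtotally_bounded V (label_dist V E l) A"
  shows "Metric_space.mtotally_bounded V (label_dist V E l) V"
proof -
  let ?d = "label_dist V E l"
  interpret Metric_space V ?d by (rule label_dist_ultrametric(1)[OF T l])
  have "infinite (A \<inter> range v)"
  proof
    assume "finite (A \<inter> range v)"
    then have "finite ((A \<inter> range v) \<union> (V - range v))" using fin by simp
    moreover have "A \<subseteq> (A \<inter> range v) \<union> (V - range v)" using A(1) by blast
    ultimately show False using A(2) finite_subset by blast
  qed
  moreover have "A \<inter> range v = v ` (v -` A)" by auto
  ultimately have J: "infinite (v -` A)" by (metis finite_imageI)
  show ?thesis unfolding mtotally_bounded_def
  proof (intro allI impI)
    fix e :: real assume e: "e > 0"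
    obtain K where K: "finite K" "A \<subseteq> (\<Union>x\<in>K. mball x e)"
      using A(3) e unfolding mtotally_bounded_def by meson
    have "\<forall>n\<in>v -` A. \<exists>k\<in>K. v n \<in> mball k e" using K(2) by blast
    from pigeonhole_infinite_rel[OF J K(1) this]
    obtain k where k: "infinite {n \<in> v -` A. v n \<in> mball k e}" by blast
    define N where "N = {n \<in> v -` A. v n \<in> mball k e}"
    have N: "infinite N" using k by (simp add: N_def)
    then obtain i where i: "i \<in> N" by (metis ex_in_conv finite.emptyI)
    have small: "l (v m) < e" if "m \<ge> i" for m
    proof -
      obtain j where j: "j \<in> N" "j > m" using N by (meson infinite_nat_iff_unbounded)
      have "v i \<in> V" "v j \<in> V" "k \<in> V" "?d k (v i) < e" "?d k (v j) < e"
        using i j by (auto simp: N_def)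
      then have "?d (v i) (v j) < e"
        using label_dist_ultrametric(2)[OF T l, of "v i" k "v j"] commute[of "v i" k] by linarith
      moreover have "l (v m) \<le> ?d (v i) (v j)"
        using v(1) j(2) that
        by (intro label_le_label_dist[OF T path_joining_sequence_segment[OF v]])
          (auto simp: inj_eq simp del: upt_Suc)
      ultimately show ?thesis by linarith
    qed
    have tail: "?d (v i) (v m) < e" if "m \<ge> i" for m
      by (rule label_dist_less[OF T path_joining_sequence_segment[OF v that]])
        (use small e in \<open>auto simp del: upt_Suc\<close>)
    let ?K = "(V - range v) \<union> v ` {..i}"
    have "x \<in> (\<Union>y\<in>?K. mball y e)" if x: "x \<in> V" for x
    proof (cases "x \<in> ?K")
      case True
      moreover have "x \<in> mball x e" using x e by (simp del: in_mball)
      ultimately show ?thesis by blast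
    next
      case False
      then obtain m where "x = v m" "m > i" using x by (auto simp: image_iff) (metis atMost_iff not_le)
      then show ?thesis using tail[of m] v(2) x by (intro UN_I[of "v i"]) auto
    qed
    then have "V \<subseteq> (\<Union>y\<in>?K. mball y e)" by (rule subsetI)
    moreover have "finite ?K" "?K \<subseteq> V" using fin v(2) by auto
    ultimately show "\<exists>K. finite K \<and> K \<subseteq> V \<and> V \<subseteq> (\<Union>x\<in>K. mball x e)" by blast
  qed
qed

section \<open>The metric condition restricts the tree\<close>

text \<open>
  The decisive labeling.  Independence of \<open>C\<close> is what makes it non-degenerate.  With \<open>C\<close> empty the
  sequence can be a ray; with \<open>C\<close> a single vertex it can run through the neighbours of that vertex.
\<close>
lemma cofinite_of_labeling_condition:
  fixes a :: "nat \<Rightarrow> 'a"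
  assumes T: "is_tree V E"
    and cond: "\<And>l :: 'a \<Rightarrow> real. \<lbrakk>nondegenerate_labeling V E l; \<exists>A \<subseteq> V. infinite A \<and>
        Metric_space.mtotally_bounded V (label_dist V E l) A\<rbrakk> \<Longrightarrow>
      Metric_space.mtotally_bounded V (label_dist V E l) V"
    and a: "inj a" "range a \<subseteq> V"
    and C: "C \<inter> range a = {}" "\<And>u v. {u, v} \<in> E \<Longrightarrow> u \<notin> C \<or> v \<notin> C"
    and paths: "\<And>m n. m \<le> n \<Longrightarrow> \<exists>p. path_joining V E (a m) (a n) p \<and> set p \<subseteq> a ` {m..} \<union> C"
  shows "finite (V - range a - C)"
proof -
  define l :: "'a \<Rightarrow> real" where
    "l x = (if x \<in> C then 0 else if x \<in> range a then 1 / real (Suc (inv a x)) else 1)" for x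
  have la: "l (a n) = 1 / real (Suc n)" for n
    using C(1) a(1) by (auto simp: l_def)
  have l: "nondegenerate_labeling V E l"
    using C(2) by (fastforce simp: nondegenerate_labeling_def l_def less_max_iff_disj)
  let ?d = "label_dist V E l"
  interpret Metric_space V ?d by (rule label_dist_ultrametric(1)[OF T l])
  have "mtotally_bounded (range a)" unfolding mtotally_bounded_def
  proof (intro allI impI)
    fix e :: real assume e: "e > 0"
    then obtain N where N: "1 / real (Suc N) < e" by (meson nat_approx_posE)
    have near: "?d (a N) (a n) < e" if n: "n \<ge> N" for n
    proof -
      obtain p where p: "path_joining V E (a N) (a n) p" "set p \<subseteq> a ` {N..} \<union> C"
        using paths[OF n] by blast
      have "l x < e" if x: "x \<in> set p" for x
      proof (cases "x \<in> C")
        case True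
        then show ?thesis using e by (simp add: l_def)
      next
        case False
        then obtain m where m: "x = a m" "m \<ge> N" using p(2) x by auto
        then have "l x \<le> 1 / real (Suc N)" by (simp add: la frac_le)
        then show ?thesis using N by linarith
      qed
      then show ?thesis by (rule label_dist_less[OF T p(1) _ e])
    qed
    have "a n \<in> (\<Union>x\<in>a ` {..N}. mball x e)" for n
    proof (cases "n \<le> N")
      case True
      then have "a n \<in> a ` {..N}" "a n \<in> mball (a n) e"
        using a(2) e by (auto simp del: in_mball)
      then show ?thesis by blast
    next
      case False
      then show ?thesis using a(2) near[of n] by (intro UN_I[of "a N"]) auto
    qed
    then show "\<exists>K. finite K \<and> K \<subseteq> range a \<and> range a \<subseteq> (\<Union>x\<in>K. mball x e)"
      by (intro exI[of _ "a ` {..N}"]) auto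
  qed
  then have "mtotally_bounded V"
    using a by (intro cond l exI[of _ "range a"]) (auto simp: range_inj_infinite)
  then obtain K where K: "finite K" "V \<subseteq> (\<Union>x\<in>K. mball x 1)"
    unfolding mtotally_bounded_def by (meson zero_less_one)
  \<comment> \<open>A point labeled \<open>1\<close> is alone in its ball of radius \<open>1\<close>.\<close>
  have "V - range a - C \<subseteq> K"
  proof
    fix b assume b: "b \<in> V - range a - C"
    then obtain k where k: "k \<in> K" "k \<in> V" "?d k b < 1" using K(2) by auto
    obtain p where p: "path_joining V E k b p"
      using tree_path_ex1[OF T k(2)] b by blast
    then have "b \<in> set p" by (auto simp: path_joining_def graph_path_def)
    moreover have "l b = 1" using b by (simp add: l_def)
    ultimately have "k = b" using label_le_label_dist[OF T p, of b l] k(3) by fastforce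
    then show "b \<in> K" using k by simp
  qed
  then show ?thesis using K(1) finite_subset by blast
qed

text \<open>
  Every path between neighbours of \<open>c\<close> runs through \<open>c\<close>, so infinitely many neighbours could be
  split into two infinite halves, one forming a sequence as in the previous lemma and the other
  violating its conclusion.
\<close>
lemma locally_finite_of_labeling_condition:
  fixes V :: "'a set"
  assumes T: "is_tree V E"
    and cond: "\<And>l :: 'a \<Rightarrow> real. \<lbrakk>nondegenerate_labeling V E l; \<exists>A \<subseteq> V. infinite A \<and>
        Metric_space.mtotally_bounded V (label_dist V E l) A\<rbrakk> \<Longrightarrow>
      Metric_space.mtotally_bounded V (label_dist V E l) V"
  shows "finite {x. {c, x} \<in> E}"
proof (rule ccontr)
  assume "infinite {x. {c, x} \<in> E}"
  then obtain f :: "nat \<Rightarrow> 'a" where f: "inj f" "range f \<subseteq> {x. {c, x} \<in> E}"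
    by (meson infinite_countable_subset)
  have edge: "u \<noteq> v \<and> u \<in> V \<and> v \<in> V" if "{u, v} \<in> E" for u v
    using T that by (fastforce simp: is_tree_def simple_graph_def doubleton_eq_iff)
  have fc: "f n \<noteq> c" "f n \<in> V" "c \<in> V" "{c, f n} \<in> E" for n
    using f(2) edge[of c "f n"] by auto
  let ?a = "\<lambda>n. f (2 * n)"
  have "\<exists>p. path_joining V E (?a m) (?a n) p \<and> set p \<subseteq> ?a ` {m..} \<union> {c}" if "m \<le> n" for m n
  proof (cases "m = n")
    case True
    then show ?thesis
      using fc by (intro exI[of _ "[?a n]"]) (auto simp: path_joining_def graph_path_def)
  next
    case False
    then show ?thesis using fc f(1) that
      by (intro exI[of _ "[?a m, c, ?a n]"])
        (auto simp: path_joining_def graph_path_def inj_eq insert_commute)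
  qed
  moreover have "inj ?a" by (rule injI) (simp add: inj_eq[OF f(1)])
  ultimately have "finite (V - range ?a - {c})"
    using fc edge[of c c] by (intro cofinite_of_labeling_condition[OF T cond]) auto
  moreover have "range (\<lambda>n. f (Suc (2 * n))) \<subseteq> V - range ?a - {c}"
  proof -
    have "f (Suc (2 * n)) \<noteq> f (2 * m)" for m n
      by (simp add: inj_eq[OF f(1)]) presburger
    then show ?thesis using fc by auto
  qed
  moreover have "inj (\<lambda>n. f (Suc (2 * n)))" by (rule injI) (simp add: inj_eq[OF f(1)])
  ultimately show False using range_inj_infinite finite_subset by blast
qed

section \<open>Rays\<close>

text \<open>
  Koenig's lemma.  A path that is an initial segment of infinitely many paths is extended by one
  vertex so that this property persists: only finitely many next vertices are possible.
\<close>
lemma konig_ray: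
  assumes conn: "graph_connected V E" and inf: "infinite V"
    and locfin: "\<And>c. c \<in> V \<Longrightarrow> finite {x. {c, x} \<in> E}"
  obtains v :: "nat \<Rightarrow> 'a" where "inj v" "range v \<subseteq> V" "\<And>n. {v n, v (Suc n)} \<in> E"
proof -
  obtain r where r: "r \<in> V" using inf by (metis ex_in_conv finite.emptyI)
  define S where "S = {p. graph_path V E p \<and> hd p = r}"
  define good where "good xs \<longleftrightarrow> xs \<noteq> [] \<and> infinite {p \<in> S. \<exists>ys. p = xs @ ys}" for xs
  have "V \<subseteq> last ` S"
    using conn r by (force simp: graph_connected_def S_def path_joining_def)
  then have "infinite S" using inf finite_surj by blast
  moreover have "S = {p \<in> S. \<exists>ys. p = [r] @ ys}"
    by (auto simp: S_def graph_path_def) (metis hd_Cons_tl)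
  ultimately have start: "good [r]" by (simp add: good_def)
  have path: "graph_path V E xs" if g: "good xs" for xs
  proof -
    have "{p \<in> S. \<exists>ys. p = xs @ ys} \<noteq> {}" using g unfolding good_def by fastforce
    then show ?thesis using g
      by (auto simp: good_def S_def graph_path_def successively_append_iff)
  qed
  have extend: "\<exists>ys. good ys \<and> (\<exists>y. ys = xs @ [y])" if g: "good xs" for xs
  proof -
    let ?P = "{p \<in> S. \<exists>ys. p = xs @ ys} - {xs}"
    let ?B = "{x. {last xs, x} \<in> E}"
    have "last xs \<in> V" using path[OF g] by (auto simp: graph_path_def)
    then have B: "finite ?B" by (rule locfin)
    have "infinite ?P" using g by (simp add: good_def)
    moreover have "\<forall>p\<in>?P. \<exists>y\<in>?B. \<exists>zs. p = (xs @ [y]) @ zs"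
    proof
      fix p assume "p \<in> ?P"
      then obtain ys where "p = xs @ ys" "ys \<noteq> []" "p \<in> S" by auto
      then obtain y zs where p: "p = xs @ y # zs" "p \<in> S" by (metis neq_Nil_conv)
      then have "{last xs, y} \<in> E" using g
        by (auto simp: S_def graph_path_def successively_append_iff good_def)
      then show "\<exists>y\<in>?B. \<exists>zs. p = (xs @ [y]) @ zs" using p by auto
    qed
    ultimately have "\<exists>y\<in>?B. infinite {p \<in> ?P. \<exists>zs. p = (xs @ [y]) @ zs}"
      using pigeonhole_infinite_rel[OF _ B, of ?P "\<lambda>p y. \<exists>zs. p = (xs @ [y]) @ zs"] by simp
    then obtain y where y: "infinite {p \<in> ?P. \<exists>zs. p = (xs @ [y]) @ zs}" by (rule bexE)
    have "infinite {p \<in> S. \<exists>zs. p = (xs @ [y]) @ zs}"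
      by (rule infinite_super[OF _ y]) auto
    then have "good (xs @ [y])" unfolding good_def by simp
    then show ?thesis by blast
  qed
  obtain X where X: "\<And>n. good (X n)" "\<And>n. \<exists>y. X (Suc n) = X n @ [y]"
    using dependent_nat_choice[of "\<lambda>_. good" "\<lambda>_ xs ys. \<exists>y. ys = xs @ [y]"] start extend by blast
  define v where "v n = last (X n)" for n
  have Xs: "X (Suc n) = X n @ [v (Suc n)]" for n
    using X(2)[of n] by (auto simp: v_def)
  have ne: "X n \<noteq> []" for n using X(1) by (simp add: good_def)
  have mem: "v n \<in> set (X n)" for n using ne by (simp add: v_def)
  have mono: "set (X m) \<subseteq> set (X n)" if "m \<le> n" for m n
    by (rule lift_Suc_mono_le[OF _ that]) (auto simp: Xs)
  have P: "graph_path V E (X n)" for n using X(1) path by blast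
  have "v m \<noteq> v n" if "m < n" for m n
  proof -
    obtain k where k: "n = Suc k" "m \<le> k" using \<open>m < n\<close> by (cases n) auto
    then show ?thesis using P[of n] mem[of m] mono[of m k] Xs[of k] by (auto simp: graph_path_def)
  qed
  then have "inj v" by (meson linorder_injI)
  moreover have "range v \<subseteq> V" using P mem by (auto simp: graph_path_def)
  moreover have "{v n, v (Suc n)} \<in> E" for n
    using P[of "Suc n"] ne[of n] unfolding Xs
    by (auto simp: graph_path_def successively_append_iff v_def)
  ultimately show ?thesis by (rule that)
qed

text \<open>
  The paths from \<open>v 0\<close> to the vertices off the ray span a finite subtree.  It contains each edge that
  is not on the ray: such an edge has an end \<open>f\<close> off the ray, since a chord of the ray would close a
  cycle, and if its other end is \<open>v j\<close>, then the path from \<open>v 0\<close> to \<open>f\<close> passes through \<open>v j\<close>.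
\<close>
lemma almost_ray_of_cofinite_ray:
  assumes T: "is_tree V E"
    and v: "inj v" "range v \<subseteq> V" "\<And>n. {v n, v (Suc n)} \<in> E"
    and fin: "finite (V - range v)"
  shows "almost_ray V E"
proof -
  let ?F = "V - range v"
  let ?ER = "range (\<lambda>n. {v n, v (Suc n)})"
  have simple: "simple_graph V E" and acyc: "\<not> (\<exists>c. graph_cycle V E c)"
    using T by (auto simp: is_tree_def)
  have edge: "x \<noteq> y \<and> x \<in> V \<and> y \<in> V" if "{x, y} \<in> E" for x y
    using simple that by (fastforce simp: simple_graph_def doubleton_eq_iff)
  have uniq: "p = q" if "path_joining V E x y p" "path_joining V E x y q" for x y p q
    using path_joining_unique[OF acyc] that by blast
  have v0: "v 0 \<in> V" using v(2) by auto
  define P where "P x = (THE p. path_joining V E (v 0) x p)" for x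
  have P: "path_joining V E (v 0) x (P x)" if "x \<in> V" for x
    unfolding P_def by (rule theI') (rule tree_path_ex1[OF T v0 that])
  have Peq: "P x = p" if "path_joining V E (v 0) x p" for x p
  proof -
    have "x \<in> V" using that by (auto simp: path_joining_def graph_path_def)
    then show ?thesis using P uniq that by blast
  qed
  \<comment> \<open>The origin is included so that the subtree is nonempty even if every vertex is on the ray.\<close>
  define V0 where "V0 = (\<Union>f\<in>insert (v 0) ?F. set (P f))"
  define E0 where "E0 = {e \<in> E. e \<subseteq> V0}"
  have V0V: "V0 \<subseteq> V"
    using P v0 unfolding V0_def path_joining_def graph_path_def by blast
  have memP: "x \<in> set (P x)" if "x \<in> V" for x
    using P[OF that] unfolding path_joining_def graph_path_def by (metis last_in_set)
  have FV0: "?F \<subseteq> V0" "v 0 \<in> V0" using memP v0 by (auto simp: V0_def)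
  have simple0: "simple_graph V0 E0"
    unfolding simple_graph_def
  proof (intro conjI ballI)
    show "V0 \<noteq> {}" using FV0 by blast
    fix e assume e: "e \<in> E0"
    then have "e \<in> E" by (simp add: E0_def)
    then obtain x y where xy: "x \<noteq> y" "e = {x, y}"
      using simple unfolding simple_graph_def by (metis (no_types))
    then have "x \<in> V0" "y \<in> V0" using e by (auto simp: E0_def)
    then show "\<exists>x\<in>V0. \<exists>y\<in>V0. x \<noteq> y \<and> e = {x, y}" using xy by blast
  qed
  have P0: "path_joining V0 E0 (v 0) x (P x)" if x: "x \<in> V0" for x
  proof -
    obtain f where f: "f \<in> insert (v 0) ?F" "x \<in> set (P f)" using x by (auto simp: V0_def)
    have fV: "f \<in> V" using f(1) v0 by auto
    obtain ys zs where split: "P f = (ys @ [x]) @ zs"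
      using f(2) by (auto dest: split_list)
    then have "path_joining V E (v 0) x (ys @ [x])"
      using path_joining_prefix[of V E "v 0" f "ys @ [x]" zs] P[OF fV] by simp
    then have px: "P x = ys @ [x]" by (rule Peq)
    have "set (P x) \<subseteq> set (P f)" by (auto simp: px split)
    then have sub: "set (P x) \<subseteq> V0" using f(1) unfolding V0_def by blast
    have "path_joining V E (v 0) x (P x)" using P x V0V by blast
    moreover from this have "successively (\<lambda>a b. {a, b} \<in> E0) (P x)"
      using sub unfolding path_joining_def graph_path_def
      by (auto simp: E0_def subset_iff elim!: successively_mono)
    ultimately show ?thesis using sub by (simp add: path_joining_def graph_path_def)
  qed
  have conn0: "graph_connected V0 E0"
    unfolding graph_connected_def
  proof (intro ballI)
    fix x y assume "x \<in> V0" "y \<in> V0"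
    then show "\<exists>p. path_joining V0 E0 x y p"
      using path_joining_trans[OF path_joining_rev[OF P0] P0] by blast
  qed
  have acyc0: "\<not> (\<exists>c. graph_cycle V0 E0 c)"
  proof
    assume "\<exists>c. graph_cycle V0 E0 c"
    then obtain c where c: "graph_cycle V0 E0 c" by blast
    then have "successively (\<lambda>x y. {x, y} \<in> E) c"
      unfolding graph_cycle_def graph_path_def by (auto simp: E0_def elim!: successively_mono)
    then have "graph_cycle V E c"
      using c V0V by (auto simp: graph_cycle_def graph_path_def E0_def)
    then show False using acyc by blast
  qed
  have chord: "{v i, v j} \<in> ?ER" if e: "{v i, v j} \<in> E" "i \<le> j" for i j
  proof -
    have "path_joining V E (v i) (v j) [v i, v j]"
      using e edge[of "v i" "v j"] by (auto simp: path_joining_def graph_path_def)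
    then have "map v [i..<Suc j] = [v i, v j]"
      using path_joining_sequence_segment[OF v e(2)] uniq by blast
    then have "length (map v [i..<Suc j]) = length [v i, v j]" by (rule arg_cong)
    then have "j = Suc i" using e(2) by simp
    then show ?thesis by auto
  qed
  have off: "{f, w} \<in> E0" if e: "{f, w} \<in> E" and f: "f \<notin> range v" for f w
  proof -
    have fF: "f \<in> ?F" and w: "w \<in> V" using edge[OF e] f by auto
    have "w \<in> V0"
    proof (cases "w \<in> range v")
      case True
      then obtain j where j: "w = v j" by blast
      have "path_joining V E (v 0) f (map v [0..<Suc j] @ [f])"
        using e f fF j path_joining_sequence_segment[OF v, of 0 j]
        by (intro path_joining_snoc) (auto simp: insert_commute simp del: upt_Suc)
      then have "P f = map v [0..<Suc j] @ [f]" by (rule Peq)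
      then have "w \<in> set (P f)" using j by simp
      then show ?thesis using fF by (auto simp: V0_def)
    qed (use w FV0 in auto)
    then show ?thesis using e fF FV0 by (auto simp: E0_def)
  qed
  have "E \<subseteq> E0 \<union> ?ER"
  proof
    fix e assume e: "e \<in> E"
    then obtain x y where xy: "e = {x, y}"
      using simple unfolding simple_graph_def by (metis (no_types))
    show "e \<in> E0 \<union> ?ER"
    proof (cases "x \<in> range v \<and> y \<in> range v")
      case True
      then obtain i j where ij: "x = v i" "y = v j" by blast
      show ?thesis
        using chord[of i j] chord[of j i] e xy ij nat_le_linear[of i j]
        by (metis UnCI insert_commute)
    next
      case False
      then show ?thesis using off[of x y] off[of y x] e xy by (metis UnCI insert_commute)
    qed
  qed
  then have E: "E = E0 \<union> ?ER" using v(3) by (auto simp: E0_def)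
  have ray: "is_ray (range v) ?ER" using v(1) by (auto simp: is_ray_def)
  have "simple_graph (range v) ?ER"
    unfolding simple_graph_def
  proof (intro conjI ballI)
    fix e assume "e \<in> ?ER"
    then obtain n where "e = {v n, v (Suc n)}" by blast
    moreover have "v n \<noteq> v (Suc n)" using inj_eq[OF v(1)] by simp
    ultimately show "\<exists>x\<in>range v. \<exists>y\<in>range v. x \<noteq> y \<and> e = {x, y}" by blast
  qed simp
  then have subray: "subgraph_of (range v) ?ER V E"
    using simple v by (auto simp: subgraph_of_def)
  have "infinite V" using v(1,2) range_inj_infinite finite_subset by blast
  moreover have "finite V0" using fin by (simp add: V0_def)
  moreover have "V = V0 \<union> range v" using V0V FV0 v(2) by blast
  moreover have "subgraph_of V0 E0 V E"
    using simple simple0 V0V by (auto simp: subgraph_of_def E0_def)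
  moreover have "is_tree V0 E0" using simple0 conn0 acyc0 by (simp add: is_tree_def)
  ultimately show ?thesis
    using T ray subray E unfolding almost_ray_def by blast
qed

section \<open>The characterization\<close>

theorem theorem4p3:
  fixes V :: "'a set" and E :: "'a set set"
  assumes "is_tree V E" and "infinite V"
  shows "almost_ray V E \<longleftrightarrow>
    (\<forall>l :: 'a \<Rightarrow> real. nondegenerate_labeling V E l \<longrightarrow>
      (Metric_space.mtotally_bounded V (label_dist V E l) V \<longleftrightarrow>
       (\<exists>A \<subseteq> V. infinite A \<and> Metric_space.mtotally_bounded V (label_dist V E l) A)))"
proof (intro iffI allI impI)
  fix l :: "'a \<Rightarrow> real"
  assume "Metric_space.mtotally_bounded V (label_dist V E l) V"
  then show "\<exists>A \<subseteq> V. infinite A \<and> Metric_space.mtotally_bounded V (label_dist V E l) A"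
    using assms(2) by blast
next
  fix l :: "'a \<Rightarrow> real"
  assume ray: "almost_ray V E" and l: "nondegenerate_labeling V E l"
    and A: "\<exists>A \<subseteq> V. infinite A \<and> Metric_space.mtotally_bounded V (label_dist V E l) A"
  obtain VR ER V0 where R: "is_ray VR ER" "subgraph_of VR ER V E" "finite V0" "V = V0 \<union> VR"
    using ray unfolding almost_ray_def by blast
  obtain v :: "nat \<Rightarrow> 'a" where v: "inj v" "VR = range v" "ER = range (\<lambda>n. {v n, v (Suc n)})"
    using R(1) unfolding is_ray_def by blast
  have "range v \<subseteq> V" "{v n, v (Suc n)} \<in> E" for n
    using R(2) v by (auto simp: subgraph_of_def)
  moreover have "finite (V - range v)"
    using R(3,4) v(2) by (auto intro: finite_subset[of _ V0])
  ultimately show "Metric_space.mtotally_bounded V (label_dist V E l) V"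
    using mtotally_bounded_of_infinite_subset[OF assms(1) l v(1)] A by blast
next
  assume "\<forall>l :: 'a \<Rightarrow> real. nondegenerate_labeling V E l \<longrightarrow>
      (Metric_space.mtotally_bounded V (label_dist V E l) V \<longleftrightarrow>
       (\<exists>A \<subseteq> V. infinite A \<and> Metric_space.mtotally_bounded V (label_dist V E l) A))"
  then have cond: "Metric_space.mtotally_bounded V (label_dist V E l) V"
    if "nondegenerate_labeling V E l"
      "\<exists>A \<subseteq> V. infinite A \<and> Metric_space.mtotally_bounded V (label_dist V E l) A"
    for l :: "'a \<Rightarrow> real"
    using that by blast
  have "finite {x. {c, x} \<in> E}" for c
    by (rule locally_finite_of_labeling_condition[OF assms(1) cond])
  moreover have "graph_connected V E" using assms(1) by (simp add: is_tree_def)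
  ultimately obtain v :: "nat \<Rightarrow> 'a"
    where v: "inj v" "range v \<subseteq> V" "\<And>n. {v n, v (Suc n)} \<in> E"
    using konig_ray[OF _ assms(2)] by metis
  have "\<exists>p. path_joining V E (v m) (v n) p \<and> set p \<subseteq> v ` {m..} \<union> {}" if "m \<le> n" for m n
    using path_joining_sequence_segment[OF v that]
    by (intro exI[of _ "map v [m..<Suc n]"]) (auto simp del: upt_Suc)
  then have "finite (V - range v - {})"
    using v by (intro cofinite_of_labeling_condition[OF assms(1) cond]) auto
  then show "almost_ray V E"
    using almost_ray_of_cofinite_ray[OF assms(1) v] by simp
qed

end
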